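(* Let $n\in\mathbb{N}$. There is a (randomised) stopping time $\tau\le n$, that has no knowledge of the increment distribution (the same stopping rule is used for all increment distributions), such that for every probability distribution $F$ on $\mathbb{R}$ and random walk $(S_k)_{0\le k\le n}$ with $S_0=0$, $S_k=\sum_{i=1}^kX_i$, $X_i$ i.i.d. with distribution $F$, $$\mathbb{E}[S_\tau^+]\ \ge\ \frac{1}{H_n}\,\mathbb{E}\Big[\max_{0\le k\le n}S_k\Big],$$ where $H_n=\sum_{k=1}^n\frac1k$ is the $n$-th harmonic number. Moreover, the constant $1/H_n$ is optimal: for every $c>1/H_n$ there is no (possibly randomised) stopping rule, chosen without knowledge of $F$, such that $\mathbb{E}[S_\tau^+]\ge c\,\mathbb{E}[\max_{0\le k\le n}S_k]$ for all probability distributions $F$ on $\mathbb{R}$.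
   Context: Notation: $x^+=\max\{0,x\}$. The decision-maker sequentially observes the rewards $S_1^+,\dots,S_n^+$. A (possibly randomised) stopping rule without auxiliary information is a family of measurable functions $r_k(z_1,\dots,z_k)\in[0,1]$, $1\le k\le n$, giving the probability of stopping at time $k$ given $S_1^+=z_1,\dots,S_k^+=z_k$ and not having stopped earlier; the induced stopping time is $\tau=\inf\{k\le n:U_k\le r_k(S_1^+,\dots,S_k^+)\}$ with $U_1,\dots,U_n$ i.i.d. uniform on $(0,1)$ independent of the walk. If the rule never stops, the reward is $0$. *)

theory Defs
  imports "HOL-Probability.Probability"
begin

definition walk :: "(nat \<Rightarrow> real) \<Rightarrow> nat \<Rightarrow> real" where
  "walk x k = (\<Sum>i = 1..k. x i)"

definition pos_walk :: "(nat \<Rightarrow> real) \<Rightarrow> nat \<Rightarrow> real" where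
  "pos_walk x k = max 0 (walk x k)"

text \<open>
  A randomised stopping rule: \<open>r k z\<close> is the probability of stopping at time \<open>k\<close> after the rewards
  \<open>z 1, \<dots>, z k\<close> have been observed (as an element of the product space over \<open>{1..k}\<close>) and the rule
  has not stopped earlier. It is a function of the observed rewards only.
\<close>

definition stopping_rule :: "nat \<Rightarrow> (nat \<Rightarrow> (nat \<Rightarrow> real) \<Rightarrow> real) \<Rightarrow> bool" where
  "stopping_rule n r \<longleftrightarrow>
     (\<forall>k\<in>{1..n}. r k \<in> borel_measurable (PiM {1..k} (\<lambda>_. borel)) \<and>
                 (\<forall>z\<in>space (PiM {1..k} (\<lambda>_. borel)). r k z \<in> {0..1}))"

text \<open>
  The stopping time induced by the increments \<open>x\<close> and the randomisation variables \<open>u\<close>. The infimum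
  of the empty set is \<open>\<infinity>\<close>: this is the case in which the rule never stops, and then the reward is \<open>0\<close>.
\<close>

definition stop_time ::
  "nat \<Rightarrow> (nat \<Rightarrow> (nat \<Rightarrow> real) \<Rightarrow> real) \<Rightarrow> (nat \<Rightarrow> real) \<Rightarrow> (nat \<Rightarrow> real) \<Rightarrow> enat" where
  "stop_time n r x u = (INF k\<in>{k\<in>{1..n}. u k \<le> r k (restrict (pos_walk x) {1..k})}. enat k)"

definition reward ::
  "nat \<Rightarrow> (nat \<Rightarrow> (nat \<Rightarrow> real) \<Rightarrow> real) \<Rightarrow> (nat \<Rightarrow> real) \<Rightarrow> (nat \<Rightarrow> real) \<Rightarrow> real" where
  "reward n r x u = (case stop_time n r x u of enat k \<Rightarrow> pos_walk x k | \<infinity> \<Rightarrow> 0)"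

text \<open>
  The joint law of the i.i.d. increments with distribution \<open>F\<close> and the i.i.d. uniform randomisation
  variables, which are independent of the increments. The expectations below depend only on this
  law. They are expectations of nonnegative variables, taken in \<open>[0, \<infinity>]\<close>, so that no moment
  condition on \<open>F\<close> is needed.
\<close>

definition walk_space :: "nat \<Rightarrow> real measure \<Rightarrow> ((nat \<Rightarrow> real) \<times> (nat \<Rightarrow> real)) measure" where
  "walk_space n F =
     PiM {1..n} (\<lambda>_. F) \<Otimes>\<^sub>M PiM {1..n} (\<lambda>_. uniform_measure lborel {0<..<1})"

definition expected_reward ::
  "nat \<Rightarrow> (nat \<Rightarrow> (nat \<Rightarrow> real) \<Rightarrow> real) \<Rightarrow> real measure \<Rightarrow> ennreal" where
  "expected_reward n r F = (\<integral>\<^sup>+(x, u). ennreal (reward n r x u) \<partial>walk_space n F)"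

text \<open>The maximum includes \<open>walk x 0 = 0\<close>, so it is nonnegative and \<open>ennreal\<close> does not truncate it.\<close>

definition expected_max :: "nat \<Rightarrow> real measure \<Rightarrow> ennreal" where
  "expected_max n F = (\<integral>\<^sup>+(x, u). ennreal (Max (walk x ` {0..n})) \<partial>walk_space n F)"

end

theory Submission
  imports Defs
begin

text \<open>
  \<^bold>\<open>Achieving \<open>1 / H\<^sub>n\<close>.\<close> Spitzer's identity says
  \<open>E (max S) = (\<Sum>k=1..n. E S\<^sub>k\<^sup>+ / k)\<close>. The right-hand side is \<open>H\<^sub>n\<close> times the mean reward of a
  random time that ignores the walk and equals \<open>k\<close> with probability \<open>1 / (k H\<^sub>n)\<close>. So ignoring all
  observations is already enough, and the inequality holds with equality for every \<open>F\<close>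
  (\<open>expected_reward_harmonic_rule\<close>).

  Spitzer's identity (\<open>spitzer_identity\<close>) is proved by a cyclic argument. Write \<open>M\<^sub>m\<close> for the running
  maximum. If \<open>S\<^sub>m \<le> 0\<close>, then \<open>M\<^sub>m = M\<^sub>m\<^sub>-\<^sub>1\<close>; if \<open>S\<^sub>m > 0\<close>, then \<open>M\<^sub>m\<close> is \<open>X\<^sub>1\<close> plus the running
  maximum at time \<open>m - 1\<close> of the walk whose first \<open>m\<close> increments are rotated by one place. Summed
  over all \<open>m\<close> rotations, these first increments add up to \<open>S\<^sub>m\<close>, which gives the pathwise identity
  \<open>sum_walk_max_cyclic_shifts\<close>. All its terms are nonnegative, so it can be integrated in
  \<open>[0, \<infinity>]\<close> even if \<open>F\<close> has no mean; as the increments are exchangeable, each rotation contributes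
  the same expectation, and \<open>E M\<^sub>m = E M\<^sub>m\<^sub>-\<^sub>1 + E S\<^sub>m\<^sup>+ / m\<close> follows.

  \<^bold>\<open>Optimality.\<close> Let the increments be \<open>1\<close> with probability \<open>p\<close> and \<open>- n\<close> otherwise. After the first
  step down the walk stays nonpositive, so as long as there is anything to gain the observed rewards
  are \<open>1, 2, 3, \<dots>\<close>, whatever \<open>p\<close> is. A rule therefore enters only through the probabilities \<open>q\<^sub>k\<close> of
  stopping at time \<open>k\<close> along this one path, and these do not depend on \<open>p\<close>. The mean reward is
  \<open>\<Sum>k. k q\<^sub>k p\<^sup>k\<close>, and the mean maximum is at least \<open>\<Sum>k. p\<^sup>k\<close>. If the rule guarantees the factor \<open>c\<close>,
  then \<open>c (\<Sum>k. p\<^sup>k) \<le> (\<Sum>k. k q\<^sub>k p\<^sup>k)\<close> for all \<open>p\<close> in \<open>(0, 1)\<close>. Integrating against \<open>dp / p\<close> turns this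
  into \<open>c H\<^sub>n \<le> (\<Sum>k. q\<^sub>k) \<le> 1\<close>; the weight \<open>dp / p\<close> is the mixture of distributions under which stopping
  at any time \<open>k\<close> is equally good.
\<close>

section \<open>Stopping times and randomisation\<close>

text \<open>
  The threshold \<open>\<rho> j\<close> stands for the stopping probability at time \<open>j\<close> with the observations already
  inserted, so that the same notion serves rules that ignore the walk and rules that are followed
  along a fixed path.
\<close>

definition stops_at :: "(nat \<Rightarrow> real) \<Rightarrow> nat \<Rightarrow> (nat \<Rightarrow> real) \<Rightarrow> bool" where
  "stops_at \<rho> k u \<longleftrightarrow> u k \<le> \<rho> k \<and> (\<forall>j\<in>{1..<k}. \<rho> j < u j)"

lemma stop_time_eq_enat_iff:
  "stop_time n r x u = enat k \<longleftrightarrow>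
     k \<in> {1..n} \<and> stops_at (\<lambda>j. r j (restrict (pos_walk x) {1..j})) k u"
proof -
  define K where "K = {k\<in>{1..n}. u k \<le> r k (restrict (pos_walk x) {1..k})}"
  have st: "stop_time n r x u = (if K = {} then \<infinity> else enat (Min K))"
  proof (cases "K = {}")
    case False
    have fin: "finite K" by (auto simp: K_def)
    have "(INF k\<in>K. enat k) = enat (Min K)"
      using False fin by (intro antisym INF_greatest INF_lower) auto
    with False show ?thesis by (simp add: stop_time_def K_def)
  next
    case True
    then show ?thesis by (simp only: stop_time_def K_def[symmetric]) (simp add: top_enat_def)
  qed
  have fin: "finite K" by (auto simp: K_def)
  have "K \<noteq> {} \<and> Min K = k \<longleftrightarrow> k \<in> K \<and> (\<forall>j\<in>K. k \<le> j)"
    using fin by (metis Min_eqI Min_in Min_le empty_iff)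
  also have "\<dots> \<longleftrightarrow> k \<in> {1..n} \<and> stops_at (\<lambda>j. r j (restrict (pos_walk x) {1..j})) k u"
    by (force simp: K_def stops_at_def)
  finally show ?thesis by (auto simp: st)
qed

text \<open>
  Splitting the reward by the time at which the rule stops makes it a finite sum of products. When
  the thresholds do not depend on the walk, each product separates the walk from the randomisation.
\<close>

lemma reward_eq_sum:
  "reward n r x u = (\<Sum>k=1..n. pos_walk x k *
     indicator {u. stops_at (\<lambda>j. r j (restrict (pos_walk x) {1..j})) k u} u)"
proof (cases "stop_time n r x u")
  case (enat m)
  note iff = stop_time_eq_enat_iff[of n r x u]
  have "(\<Sum>k=1..n. pos_walk x k *
     indicator {u. stops_at (\<lambda>j. r j (restrict (pos_walk x) {1..j})) k u} u) =
     (\<Sum>k=1..n. if k = m then pos_walk x k else 0)"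
  proof (intro sum.cong refl)
    fix k assume "k \<in> {1..n}"
    then have "stops_at (\<lambda>j. r j (restrict (pos_walk x) {1..j})) k u \<longleftrightarrow> k = m"
      using iff[of k] enat by auto
    then show "pos_walk x k *
        indicator {u. stops_at (\<lambda>j. r j (restrict (pos_walk x) {1..j})) k u} u =
        (if k = m then pos_walk x k else 0)"
      by (simp only: indicator_def mem_Collect_eq) simp
  qed
  also have "\<dots> = pos_walk x m" using iff[of m] enat by simp
  finally show ?thesis using enat by (simp add: reward_def)
next
  case infinity
  then have "\<not> stops_at (\<lambda>j. r j (restrict (pos_walk x) {1..j})) k u" if "k \<in> {1..n}" for k
    using stop_time_eq_enat_iff[of n r x u k] that by auto
  then show ?thesis using infinity by (auto simp: reward_def)
qed

abbreviation unif :: "real measure" where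
  "unif \<equiv> uniform_measure lborel {0<..<1}"

definition stop_prob :: "(nat \<Rightarrow> real) \<Rightarrow> nat \<Rightarrow> real" where
  "stop_prob \<rho> k = \<rho> k * (\<Prod>j=1..<k. 1 - \<rho> j)"

lemma stop_prob_nonneg:
  assumes "\<And>j. j \<in> {1..n} \<Longrightarrow> \<rho> j \<in> {0..1}" "k \<in> {1..n}"
  shows "0 \<le> stop_prob \<rho> k"
  unfolding stop_prob_def using assms by (intro mult_nonneg_nonneg prod_nonneg) auto

text \<open>For thresholds in \<open>[0, 1]\<close> the product on the right is the probability of never stopping.\<close>

lemma sum_stop_prob: "(\<Sum>k=1..n. stop_prob \<rho> k) = 1 - (\<Prod>j=1..n. 1 - \<rho> j)"
proof (induction n)
  case (Suc n)
  have "{1..<Suc n} = {1..n}" by auto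
  with Suc show ?case by (simp add: stop_prob_def algebra_simps)
qed simp

lemma prob_space_unif: "prob_space unif"
  by (intro prob_space_uniform_measure) auto

lemma ennreal_divide_1: "x / (1::ennreal) = x"
  by (simp add: divide_ennreal_def)

lemma emeasure_unif_atMost:
  assumes "a \<in> {0..1}"
  shows "emeasure unif {..a} = ennreal a"
proof (cases "a = 1")
  case True
  then have "{0<..<1} \<inter> {..a} = {0<..<1::real}" by auto
  then show ?thesis using True by simp
next
  case False
  then have "{0<..<1} \<inter> {..a} = {0<..a}" using assms by auto
  then show ?thesis using assms by (simp add: ennreal_divide_1)
qed

lemma emeasure_unif_greaterThan:
  assumes "a \<in> {0..1}"
  shows "emeasure unif {a<..} = ennreal (1 - a)"
proof -
  have "{0<..<1} \<inter> {a<..} = {a<..<1::real}" using assms by auto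
  then show ?thesis using assms by (simp add: ennreal_divide_1)
qed

text \<open>
  Stopping at \<open>k\<close> with fixed thresholds is a box in the cube of the randomisation variables, so its
  probability is the product of the lengths of the edges.
\<close>

lemma nn_integral_stops_at:
  assumes \<rho>: "\<And>j. j \<in> {1..n} \<Longrightarrow> \<rho> j \<in> {0..1}" and k: "k \<in> {1..n}"
  shows "(\<integral>\<^sup>+u. indicator {u. stops_at \<rho> k u} u \<partial>PiM {1..n} (\<lambda>_. unif)) = ennreal (stop_prob \<rho> k)"
proof -
  interpret product_prob_space "\<lambda>_. unif" "{1..n}"
    by (intro product_prob_spaceI prob_space_unif)
  define B where "B = (\<lambda>j. if j < k then {\<rho> j<..} else if j = k then {..\<rho> k} else UNIV)"
  have eq: "indicator {u. stops_at \<rho> k u} u = (indicator (PiE {1..n} B) u :: ennreal)"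
    if "u \<in> space (PiM {1..n} (\<lambda>_. unif))" for u
    using that k by (auto simp: indicator_def stops_at_def B_def space_PiM PiE_iff split: if_splits)
  have B: "B j \<in> sets borel" for j by (auto simp: B_def)
  have "(\<integral>\<^sup>+u. indicator {u. stops_at \<rho> k u} u \<partial>PiM {1..n} (\<lambda>_. unif)) =
        emeasure (PiM {1..n} (\<lambda>_. unif)) (PiE {1..n} B)"
    using B by (subst nn_integral_indicator[symmetric])
       (auto intro!: nn_integral_cong sets_PiM_I_finite simp: eq simp del: One_nat_def nn_integral_indicator)
  also have "\<dots> = (\<Prod>j=1..n. emeasure unif (B j))"
    using B by (intro emeasure_PiM) auto
  also have "\<dots> = (\<Prod>j\<in>{1..<k} \<union> ({k} \<union> {k<..n}). emeasure unif (B j))"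
    using k by (intro prod.cong) auto
  also have "\<dots> = (\<Prod>j=1..<k. emeasure unif (B j)) *
      (emeasure unif (B k) * (\<Prod>j\<in>{k<..n}. emeasure unif (B j)))"
    by (subst prod.union_disjoint; (auto)?)+
  also have "(\<Prod>j\<in>{k<..n}. emeasure unif (B j)) = 1"
    using prob_space.emeasure_space_1[OF prob_space_unif]
    by (intro prod.neutral) (auto simp: B_def simp del: emeasure_uniform_measure)
  also have "(\<Prod>j=1..<k. emeasure unif (B j)) = (\<Prod>j=1..<k. ennreal (1 - \<rho> j))"
    using \<rho> k by (intro prod.cong refl) (simp add: B_def emeasure_unif_greaterThan del: emeasure_uniform_measure)
  also have "\<dots> = ennreal (\<Prod>j=1..<k. 1 - \<rho> j)"
    using \<rho> k by (intro prod_ennreal) (auto simp: atLeastLessThan_iff)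
  also have "emeasure unif (B k) = ennreal (\<rho> k)"
    using \<rho> k by (simp add: B_def emeasure_unif_atMost del: emeasure_uniform_measure)
  also have "ennreal (\<Prod>j=1..<k. 1 - \<rho> j) * (ennreal (\<rho> k) * 1) = ennreal (stop_prob \<rho> k)"
    using \<rho> k unfolding stop_prob_def
    by (subst (2) mult.commute, subst ennreal_mult) (auto intro!: prod_nonneg)
  finally show ?thesis .
qed

lemma nn_integral_walk_space_mult:
  assumes F: "real_distribution F"
    and f: "f \<in> borel_measurable (PiM {1..n} (\<lambda>_. F))"
    and g: "g \<in> borel_measurable (PiM {1..n} (\<lambda>_. unif))"
  shows "(\<integral>\<^sup>+(x, u). f x * g u \<partial>walk_space n F) =
         (\<integral>\<^sup>+x. f x \<partial>PiM {1..n} (\<lambda>_. F)) * (\<integral>\<^sup>+u. g u \<partial>PiM {1..n} (\<lambda>_. unif))"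
proof -
  interpret U: prob_space "PiM {1..n} (\<lambda>_. unif)"
    by (intro prob_space_PiM prob_space_unif)
  have fg: "(\<lambda>(x, u). f x * g u) \<in> borel_measurable (PiM {1..n} (\<lambda>_. F) \<Otimes>\<^sub>M PiM {1..n} (\<lambda>_. unif))"
    using measurable_compose[OF measurable_fst f] measurable_compose[OF measurable_snd g]
    unfolding split_beta by (intro borel_measurable_times_ennreal)
  have "(\<integral>\<^sup>+(x, u). f x * g u \<partial>walk_space n F) =
        (\<integral>\<^sup>+x. (\<integral>\<^sup>+u. f x * g u \<partial>PiM {1..n} (\<lambda>_. unif)) \<partial>PiM {1..n} (\<lambda>_. F))"
    unfolding walk_space_def using U.nn_integral_fst[OF fg] by simp
  also have "\<dots> = (\<integral>\<^sup>+x. f x * (\<integral>\<^sup>+u. g u \<partial>PiM {1..n} (\<lambda>_. unif)) \<partial>PiM {1..n} (\<lambda>_. F))"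
    by (intro nn_integral_cong nn_integral_cmult g)
  also have "\<dots> = (\<integral>\<^sup>+x. f x \<partial>PiM {1..n} (\<lambda>_. F)) * (\<integral>\<^sup>+u. g u \<partial>PiM {1..n} (\<lambda>_. unif))"
    by (intro nn_integral_multc f)
  finally show ?thesis .
qed

lemma measurable_stops_at [measurable]:
  assumes "k \<in> {1..n}"
  shows "(\<lambda>u. indicator {u. stops_at \<rho> k u} u :: ennreal) \<in> borel_measurable (PiM {1..n} (\<lambda>_. unif))"
proof -
  have [measurable]: "(\<lambda>u. u j) \<in> borel_measurable (PiM {1..n} (\<lambda>_. unif))" if "j \<in> {1..n}" for j
    using measurable_component_singleton[of j "{1..n}" "\<lambda>_. unif"] that by simp
  have "Measurable.pred (PiM {1..n} (\<lambda>_. unif)) (\<lambda>u. u k \<le> \<rho> k \<and> (\<forall>j\<in>{1..<k}. \<rho> j < u j))"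
    using assms by (intro pred_intros_logic pred_intros_finite) auto
  then show ?thesis
    unfolding stops_at_def by measurable
qed

lemma measurable_increment:
  assumes F: "real_distribution F" and i: "i \<in> {1..n}"
  shows "(\<lambda>x. x i) \<in> borel_measurable (PiM {1..n} (\<lambda>_. F))"
proof -
  interpret F: real_distribution F by fact
  show ?thesis
    using measurable_component_singleton[OF i, of "\<lambda>_. F"] by (simp cong: measurable_cong_sets)
qed

lemma measurable_walk:
  assumes "real_distribution F" "k \<le> n"
  shows "(\<lambda>x. walk x k) \<in> borel_measurable (PiM {1..n} (\<lambda>_. F))"
  unfolding walk_def using assms by (intro borel_measurable_sum measurable_increment) auto

text \<open>
  This is the form in which the independence of walk and randomisation is used. For a rule that
  ignores the walk, \<open>f k\<close> is \<open>S\<^sub>k\<^sup>+\<close> itself; for the upper bound it is \<open>k\<close> on the event that the first \<open>k\<close>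
  steps are all \<open>1\<close>, and \<open>0\<close> otherwise.
\<close>

lemma nn_integral_weighted_stopping:
  assumes F: "real_distribution F" and \<rho>: "\<And>j. j \<in> {1..n} \<Longrightarrow> \<rho> j \<in> {0..1}"
    and f: "\<And>k. k \<in> {1..n} \<Longrightarrow> f k \<in> borel_measurable (PiM {1..n} (\<lambda>_. F))"
    and f_nonneg: "\<And>k x. f k x \<ge> 0"
  shows "(\<integral>\<^sup>+(x, u). ennreal (\<Sum>k=1..n. f k x * indicator {u. stops_at \<rho> k u} u) \<partial>walk_space n F) =
         (\<Sum>k=1..n. (\<integral>\<^sup>+x. ennreal (f k x) \<partial>PiM {1..n} (\<lambda>_. F)) * ennreal (stop_prob \<rho> k))"
proof -
  have "(\<integral>\<^sup>+(x, u). ennreal (\<Sum>k=1..n. f k x * indicator {u. stops_at \<rho> k u} u) \<partial>walk_space n F) =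
        (\<integral>\<^sup>+z. (\<Sum>k=1..n. (case z of (x, u) \<Rightarrow> ennreal (f k x) * indicator {u. stops_at \<rho> k u} u))
           \<partial>walk_space n F)"
  proof (intro nn_integral_cong)
    fix z
    have "ennreal (\<Sum>k=1..n. f k (fst z) * indicator {u. stops_at \<rho> k u} (snd z)) =
        (\<Sum>k=1..n. ennreal (f k (fst z) * indicator {u. stops_at \<rho> k u} (snd z)))"
      by (intro sum_ennreal[symmetric] mult_nonneg_nonneg f_nonneg indicator_pos_le)
    also have "\<dots> = (\<Sum>k=1..n. ennreal (f k (fst z)) * indicator {u. stops_at \<rho> k u} (snd z))"
      by (simp only: ennreal_mult f_nonneg indicator_pos_le ennreal_indicator)
    finally show "(case z of (x, u) \<Rightarrow> ennreal (\<Sum>k=1..n. f k x * indicator {u. stops_at \<rho> k u} u)) =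
        (\<Sum>k=1..n. (case z of (x, u) \<Rightarrow> ennreal (f k x) * indicator {u. stops_at \<rho> k u} u))"
      by (simp only: split_beta)
  qed
  also have "\<dots> = (\<Sum>k=1..n. \<integral>\<^sup>+(x, u). ennreal (f k x) * indicator {u. stops_at \<rho> k u} u
           \<partial>walk_space n F)"
  proof (intro nn_integral_sum)
    fix k assume k: "k \<in> {1..n}"
    note [measurable] = f[OF k] measurable_stops_at[OF k, of \<rho>]
    show "(\<lambda>(x, u). ennreal (f k x) * indicator {u. stops_at \<rho> k u} u)
        \<in> borel_measurable (walk_space n F)"
      unfolding walk_space_def by measurable
  qed
  also have "\<dots> = (\<Sum>k=1..n. (\<integral>\<^sup>+x. ennreal (f k x) \<partial>PiM {1..n} (\<lambda>_. F)) * ennreal (stop_prob \<rho> k))"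
  proof (intro sum.cong refl)
    fix k assume k: "k \<in> {1..n}"
    show "(\<integral>\<^sup>+(x, u). ennreal (f k x) * indicator {u. stops_at \<rho> k u} u \<partial>walk_space n F) =
        (\<integral>\<^sup>+x. ennreal (f k x) \<partial>PiM {1..n} (\<lambda>_. F)) * ennreal (stop_prob \<rho> k)"
      using nn_integral_walk_space_mult[OF F measurable_compose[OF f[OF k] measurable_ennreal]
          measurable_stops_at[OF k, of \<rho>]]
        nn_integral_stops_at[OF \<rho> k] by simp
  qed
  finally show ?thesis .
qed

section \<open>Spitzer's identity\<close>

definition walk_max :: "(nat \<Rightarrow> real) \<Rightarrow> nat \<Rightarrow> real" where
  "walk_max x k = Max (walk x ` {0..k})"

text \<open>
  Rotation of \<open>{1..m}\<close> by \<open>j\<close> places, extended by the identity so that it also permutes the index set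
  \<open>{1..n}\<close> of all increments when \<open>m \<le> n\<close>. This permits an induction on \<open>m\<close> within one product space.
\<close>

definition cyclic_shift :: "nat \<Rightarrow> nat \<Rightarrow> nat \<Rightarrow> nat" where
  "cyclic_shift m j i = (if i \<in> {1..m} then if i + j \<le> m then i + j else i + j - m else i)"

lemma cyclic_shift_permutes:
  assumes "j \<le> m"
  shows "cyclic_shift m j permutes {1..m}"
proof (rule bij_imp_permutes)
  have "inj_on (cyclic_shift m j) {1..m}"
    using assms by (auto simp: inj_on_def cyclic_shift_def split: if_splits)
  moreover have "cyclic_shift m j ` {1..m} \<subseteq> {1..m}"
    using assms by (auto simp: cyclic_shift_def)
  ultimately show "bij_betw (cyclic_shift m j) {1..m} {1..m}"
    by (simp add: bij_betw_def endo_inj_surj)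
qed (auto simp: cyclic_shift_def)

lemma cyclic_shift_Suc:
  assumes "j < m"
  shows "cyclic_shift m j \<circ> cyclic_shift m 1 = cyclic_shift m (Suc j)"
  using assms by (auto simp: cyclic_shift_def fun_eq_iff)

lemma walk_permute:
  assumes "\<sigma> permutes {1..m}"
  shows "walk (x \<circ> \<sigma>) m = walk x m"
  unfolding walk_def using sum.permute[OF assms, of x] by simp

lemma walk_max_nonneg: "0 \<le> walk_max x k"
  unfolding walk_max_def by (intro Max_ge) (auto simp: walk_def intro!: image_eqI[of _ _ 0])

lemma walk_max_Suc: "walk_max x (Suc k) = max (walk_max x k) (walk x (Suc k))"
  unfolding walk_max_def by (simp add: atLeast0_atMost_Suc max.commute)

text \<open>
  As \<open>S\<^sub>k\<^sub>+\<^sub>1 > 0\<close>, the maximum is attained at a time \<open>\<ge> 1\<close>. From time \<open>1\<close> on the walk is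
  \<open>X\<^sub>1\<close> plus the walk with increments \<open>X\<^sub>2, X\<^sub>3, \<dots>\<close>, and these are the first \<open>k\<close> increments after a
  rotation by one place.
\<close>

lemma walk_max_cyclic_shift:
  assumes "walk x (Suc k) > 0"
  shows "walk_max x (Suc k) = x 1 + walk_max (x \<circ> cyclic_shift (Suc k) 1) k"
proof -
  define y where "y = x \<circ> cyclic_shift (Suc k) 1"
  have shift: "walk x (Suc i) = walk y i + x 1" if "i \<le> k" for i
  proof -
    have "walk x (Suc i) = x 1 + (\<Sum>j=1..i. x (Suc j))"
      unfolding walk_def using sum.atLeast_Suc_atMost[of 1 "Suc i" x]
      by (simp add: sum.shift_bounds_cl_Suc_ivl del: sum.cl_ivl_Suc)
    also have "(\<Sum>j=1..i. x (Suc j)) = walk y i"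
      unfolding walk_def y_def using that by (intro sum.cong) (auto simp: cyclic_shift_def)
    finally show ?thesis by simp
  qed
  have "walk x ` {1..Suc k} = (\<lambda>i. walk y i + x 1) ` {0..k}"
  proof -
    have "{1..Suc k} = Suc ` {0..k}" by (simp add: image_Suc_atLeastAtMost)
    then show ?thesis using shift by (simp only: image_image) (intro image_cong; simp)
  qed
  then have eq: "Max (walk x ` {1..Suc k}) = walk_max y k + x 1"
    unfolding walk_max_def by (simp add: Max_add_commute)
  have "{0..Suc k} = insert 0 {1..Suc k}" by auto
  then have "walk_max x (Suc k) = max (walk x 0) (Max (walk x ` {1..Suc k}))"
    unfolding walk_max_def by simp
  also have "\<dots> = Max (walk x ` {1..Suc k})"
  proof -
    have "walk x (Suc k) \<le> Max (walk x ` {1..Suc k})" by (intro Max_ge) auto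
    then show ?thesis using assms by (simp add: walk_def)
  qed
  finally show ?thesis using eq by (simp add: y_def)
qed

text \<open>
  A rotation does not change the value of \<open>S\<^sub>k\<^sub>+\<^sub>1\<close>, so all rotations fall into the same one of the two
  cases. If \<open>S\<^sub>k\<^sub>+\<^sub>1 \<le> 0\<close>, the last step never raises the maximum. Otherwise every rotation is related
  to the next one by \<open>walk_max_cyclic_shift\<close>, the rotations form a cycle, and their first increments
  run through all of \<open>X\<^sub>1, \<dots>, X\<^sub>k\<^sub>+\<^sub>1\<close>.
\<close>

lemma sum_walk_max_cyclic_shifts:
  "(\<Sum>j<Suc k. walk_max (x \<circ> cyclic_shift (Suc k) j) (Suc k)) =
     pos_walk x (Suc k) + (\<Sum>j<Suc k. walk_max (x \<circ> cyclic_shift (Suc k) j) k)"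
proof -
  let ?c = "cyclic_shift (Suc k)"
  have inv: "walk (x \<circ> ?c j) (Suc k) = walk x (Suc k)" if "j < Suc k" for j
    using that by (intro walk_permute cyclic_shift_permutes) auto
  show ?thesis
  proof (cases "walk x (Suc k) > 0")
    case False
    then have "walk_max (x \<circ> ?c j) (Suc k) = walk_max (x \<circ> ?c j) k" if "j < Suc k" for j
      using inv[OF that] walk_max_nonneg[of "x \<circ> ?c j" k] by (simp add: walk_max_Suc)
    then have "(\<Sum>j<Suc k. walk_max (x \<circ> ?c j) (Suc k)) = (\<Sum>j<Suc k. walk_max (x \<circ> ?c j) k)"
      by (intro sum.cong) auto
    then show ?thesis using False by (simp add: pos_walk_def)
  next
    case True
    have "walk_max (x \<circ> ?c j) (Suc k) = x (Suc j) + walk_max (x \<circ> ?c (Suc j)) k"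
      if "j < Suc k" for j
      using walk_max_cyclic_shift[of "x \<circ> ?c j" k] inv[OF that] True that
        cyclic_shift_Suc[of j "Suc k"]
      unfolding comp_assoc by (simp add: cyclic_shift_def)
    then have "(\<Sum>j<Suc k. walk_max (x \<circ> ?c j) (Suc k)) =
        (\<Sum>j<Suc k. x (Suc j)) + (\<Sum>j<Suc k. walk_max (x \<circ> ?c (Suc j)) k)"
      by (simp add: sum.distrib del: sum.lessThan_Suc)
    also have "(\<Sum>j<Suc k. x (Suc j)) = walk x (Suc k)"
      unfolding walk_def by (rule sum.reindex_bij_witness[of _ "\<lambda>i. i - 1" Suc]) auto
    also have "(\<Sum>j<Suc k. walk_max (x \<circ> ?c (Suc j)) k) =
        (\<Sum>j<Suc k. walk_max (x \<circ> ?c j) k)"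
    proof -
      \<comment> \<open>A full turn is the identity, so shifting the summation index by one only permutes the sum.\<close>
      have "?c (Suc k) = ?c 0" by (auto simp: cyclic_shift_def fun_eq_iff)
      then show ?thesis
        using sum.lessThan_Suc_shift[of "\<lambda>j. walk_max (x \<circ> ?c j) k" k]
        by (simp add: ac_simps)
    qed
    finally show ?thesis using True by (simp add: pos_walk_def comp_def del: sum.lessThan_Suc)
  qed
qed

text \<open>Exchangeability of independent identically distributed coordinates.\<close>

lemma nn_integral_PiM_permute:
  assumes F: "prob_space F" and \<sigma>: "\<sigma> permutes I"
    and f: "f \<in> borel_measurable (PiM I (\<lambda>_. F))"
  shows "(\<integral>\<^sup>+x. f (x \<circ> \<sigma>) \<partial>PiM I (\<lambda>_. F)) = (\<integral>\<^sup>+x. f x \<partial>PiM I (\<lambda>_. F))"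
proof -
  let ?P = "PiM I (\<lambda>_. F)"
  have eq: "x \<circ> \<sigma> = (\<lambda>i\<in>I. x (\<sigma> i))" if "x \<in> space ?P" for x
    using that permutes_not_in[OF \<sigma>]
    by (auto simp: space_PiM fun_eq_iff PiE_iff extensional_def)
  have "\<sigma> i \<in> I" if "i \<in> I" for i using that permutes_in_image[OF \<sigma>] by simp
  then have meas: "(\<lambda>x. \<lambda>i\<in>I. x (\<sigma> i)) \<in> measurable ?P ?P"
    by (intro measurable_restrict measurable_component_singleton)
  have "(\<integral>\<^sup>+x. f (x \<circ> \<sigma>) \<partial>?P) = (\<integral>\<^sup>+x. f (\<lambda>i\<in>I. x (\<sigma> i)) \<partial>?P)"
    by (intro nn_integral_cong) (simp add: eq)
  also have "\<dots> = (\<integral>\<^sup>+x. f x \<partial>distr ?P ?P (\<lambda>x. \<lambda>i\<in>I. x (\<sigma> i)))"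
    using meas f by (simp add: nn_integral_distr)
  also have "distr ?P ?P (\<lambda>x. \<lambda>i\<in>I. x (\<sigma> i)) = ?P"
    using F permutes_inj_on[OF \<sigma>] permutes_in_image[OF \<sigma>]
    by (intro distr_PiM_reindex[of I "\<lambda>_. F" \<sigma> I]) auto
  finally show ?thesis .
qed

lemma measurable_walk_max:
  assumes "real_distribution F" "k \<le> n"
  shows "(\<lambda>x. walk_max x k) \<in> borel_measurable (PiM {1..n} (\<lambda>_. F))"
  unfolding walk_max_def using assms
  by (intro borel_measurable_Max measurable_walk) auto

lemma spitzer_identity:
  assumes F: "real_distribution F" and "m \<le> n"
  shows "(\<integral>\<^sup>+x. ennreal (walk_max x m) \<partial>PiM {1..n} (\<lambda>_. F)) =
         (\<Sum>k=1..m. ennreal (1 / real k) * (\<integral>\<^sup>+x. ennreal (pos_walk x k) \<partial>PiM {1..n} (\<lambda>_. F)))"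
  using \<open>m \<le> n\<close>
proof (induction m)
  case 0
  have "walk_max x 0 = 0" for x by (simp add: walk_max_def walk_def)
  then show ?case by simp
next
  case (Suc k)
  let ?P = "PiM {1..n} (\<lambda>_. F)" and ?c = "cyclic_shift (Suc k)"
  let ?M = "\<lambda>k. \<integral>\<^sup>+x. ennreal (walk_max x k) \<partial>?P"
  let ?S = "\<integral>\<^sup>+x. ennreal (pos_walk x (Suc k)) \<partial>?P"
  interpret F: real_distribution F by fact
  have perm: "?c j permutes {1..n}" if "j < Suc k" for j
    using Suc.prems that by (intro permutes_subset[OF cyclic_shift_permutes]) auto
  have shift_meas: "(\<lambda>x. walk_max (x \<circ> ?c j) l) \<in> borel_measurable ?P" if "j < Suc k" "l \<le> n" for j l
  proof -
    have "?c j i \<in> {1..n}" if "i \<in> {1..n}" for i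
      using that permutes_in_image[OF perm[OF \<open>j < Suc k\<close>]] by blast
    then have "(\<lambda>x. x (?c j i)) \<in> borel_measurable ?P" if "i \<in> {1..n}" for i
      using that by (intro measurable_increment F)
    then show ?thesis using \<open>l \<le> n\<close> unfolding walk_max_def walk_def
      by (intro borel_measurable_Max borel_measurable_sum) auto
  qed
  have sum_shift: "(\<integral>\<^sup>+x. ennreal (\<Sum>j<Suc k. walk_max (x \<circ> ?c j) l) \<partial>?P) = of_nat (Suc k) * ?M l"
    if "l \<le> n" for l
  proof -
    have "(\<integral>\<^sup>+x. ennreal (\<Sum>j<Suc k. walk_max (x \<circ> ?c j) l) \<partial>?P) =
          (\<integral>\<^sup>+x. (\<Sum>j<Suc k. ennreal (walk_max (x \<circ> ?c j) l)) \<partial>?P)"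
      by (intro nn_integral_cong sum_ennreal[symmetric] walk_max_nonneg)
    also have "\<dots> = (\<Sum>j<Suc k. \<integral>\<^sup>+x. ennreal (walk_max (x \<circ> ?c j) l) \<partial>?P)"
      using shift_meas that by (intro nn_integral_sum measurable_compose[OF _ measurable_ennreal]) auto
    also have "\<dots> = (\<Sum>j<Suc k. ?M l)"
      using measurable_walk_max[OF F that]
      by (intro sum.cong refl nn_integral_PiM_permute[where f = "\<lambda>x. ennreal (walk_max x l)"]
            F.prob_space_axioms perm) auto
    finally show ?thesis by simp
  qed
  have "of_nat (Suc k) * ?M (Suc k) =
      (\<integral>\<^sup>+x. ennreal (pos_walk x (Suc k) + (\<Sum>j<Suc k. walk_max (x \<circ> ?c j) k)) \<partial>?P)"
    using sum_shift[OF Suc.prems] by (simp only: sum_walk_max_cyclic_shifts)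
  also have "\<dots> = (\<integral>\<^sup>+x. ennreal (pos_walk x (Suc k)) +
        ennreal (\<Sum>j<Suc k. walk_max (x \<circ> ?c j) k) \<partial>?P)"
    by (intro nn_integral_cong ennreal_plus sum_nonneg walk_max_nonneg) (simp add: pos_walk_def)
  also have "\<dots> = ?S + of_nat (Suc k) * ?M k"
  proof -
    have "(\<lambda>x. \<Sum>j<Suc k. walk_max (x \<circ> ?c j) k) \<in> borel_measurable ?P"
      using shift_meas Suc.prems by (intro borel_measurable_sum) auto
    moreover have "(\<lambda>x. pos_walk x (Suc k)) \<in> borel_measurable ?P"
      using measurable_walk[OF F Suc.prems] unfolding pos_walk_def by measurable
    ultimately show ?thesis
      using sum_shift[of k] Suc.prems by (subst nn_integral_add) (auto simp del: One_nat_def sum.lessThan_Suc)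
  qed
  finally have key: "of_nat (Suc k) * ?M (Suc k) = ?S + of_nat (Suc k) * ?M k" .
  have inv: "ennreal (1 / real (Suc k)) * (of_nat (Suc k) * a) = a" for a
  proof -
    have "ennreal (1 / real (Suc k)) * ennreal (real (Suc k)) = 1"
      by (subst ennreal_mult[symmetric]) (auto simp del: of_nat_Suc)
    then show ?thesis by (simp add: mult.assoc[symmetric] ennreal_of_nat_eq_real_of_nat del: of_nat_Suc)
  qed
  have "?M (Suc k) = ennreal (1 / real (Suc k)) * (?S + of_nat (Suc k) * ?M k)"
    using arg_cong[OF key, of "\<lambda>a. ennreal (1 / real (Suc k)) * a"] by (simp only: inv)
  also have "\<dots> = ennreal (1 / real (Suc k)) * ?S + ?M k"
    by (simp only: distrib_left inv)
  finally show ?case using Suc by (simp add: add.commute)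
qed

lemma expected_max_eq:
  assumes F: "real_distribution F"
  shows "expected_max n F = (\<integral>\<^sup>+x. ennreal (walk_max x n) \<partial>PiM {1..n} (\<lambda>_. F))"
proof -
  interpret U: prob_space "PiM {1..n} (\<lambda>_. unif)"
    by (intro prob_space_PiM prob_space_unif)
  have "expected_max n F = (\<integral>\<^sup>+(x, u). ennreal (walk_max x n) * 1 \<partial>walk_space n F)"
    by (simp add: expected_max_def walk_max_def)
  also have "\<dots> = (\<integral>\<^sup>+x. ennreal (walk_max x n) \<partial>PiM {1..n} (\<lambda>_. F)) *
      (\<integral>\<^sup>+u. 1 \<partial>PiM {1..n} (\<lambda>_. unif))"
    using measurable_walk_max[OF F, of n n]
    by (intro nn_integral_walk_space_mult F) auto
  finally show ?thesis using U.emeasure_space_1 by simp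
qed

section \<open>A rule that achieves the harmonic constant\<close>

text \<open>
  The hazard rate of the law \<open>P (\<tau> = k) = 1 / (k H\<^sub>n)\<close>: the conditional probability of \<open>\<tau> = k\<close> given
  \<open>\<tau> \<ge> k\<close>, in which the normalisation \<open>H\<^sub>n\<close> cancels.
\<close>

definition harmonic_rule :: "nat \<Rightarrow> nat \<Rightarrow> real" where
  "harmonic_rule n k = (1 / real k) / (\<Sum>j=k..n. 1 / real j)"

lemma harmonic_tail_Suc:
  "k \<le> n \<Longrightarrow> (\<Sum>j=k..n. 1 / real j) = 1 / real k + (\<Sum>j=Suc k..n. 1 / real j)"
  by (rule sum.atLeast_Suc_atMost)

lemma harmonic_tail_pos:
  assumes "k \<in> {1..n}"
  shows "(\<Sum>j=k..n. 1 / real j) > 0"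
  using assms by (intro sum_pos) auto

lemma harmonic_rule_bounds:
  assumes "k \<in> {1..n}"
  shows "harmonic_rule n k \<in> {0..1}"
proof -
  have "1 / real k \<le> (\<Sum>j=k..n. 1 / real j)"
    using assms harmonic_tail_Suc[of k n] by (simp add: sum_nonneg)
  then show ?thesis
    using harmonic_tail_pos[OF assms] unfolding harmonic_rule_def atLeastAtMost_iff
    by (subst divide_le_eq_1_pos) simp_all
qed

text \<open>With \<open>T\<^sub>k = 1/k + \<dots> + 1/n\<close> each factor is \<open>T\<^sub>j\<^sub>+\<^sub>1 / T\<^sub>j\<close>, so the product telescopes.\<close>

lemma prod_harmonic_rule:
  assumes "k < n"
  shows "(\<Prod>j=1..<Suc k. 1 - harmonic_rule n j) = (\<Sum>j=Suc k..n. 1 / real j) / harm n"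
  using assms
proof (induction k)
  case 0
  then have "harm n > (0::real)" by simp
  then show ?case by (simp add: harm_def divide_inverse)
next
  case (Suc k)
  let ?T = "\<lambda>k. \<Sum>j=k..n. 1 / real j"
  have T: "?T (Suc k) > 0" using Suc.prems by (intro harmonic_tail_pos) auto
  have "1 - harmonic_rule n (Suc k) = ?T (Suc (Suc k)) / ?T (Suc k)"
    using T harmonic_tail_Suc[of "Suc k" n] Suc.prems
    unfolding harmonic_rule_def by (subst diff_divide_eq_iff) simp_all
  then show ?case using Suc T by (simp add: prod.atLeastLessThan_Suc)
qed

lemma stop_prob_harmonic_rule:
  assumes "k \<in> {1..n}"
  shows "stop_prob (harmonic_rule n) k = 1 / harm n * (1 / real k)"
proof -
  obtain l where l: "k = Suc l" "l < n" using assms by (cases k) auto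
  then show ?thesis
    using prod_harmonic_rule[of l n] harmonic_tail_pos[OF assms]
    by (simp add: stop_prob_def harmonic_rule_def)
qed

text \<open>
  The rule stops at time \<open>k\<close> independently of the walk with probability \<open>1 / (k H\<^sub>n)\<close>, so its mean
  reward is the right-hand side of Spitzer's identity divided by \<open>H\<^sub>n\<close>.
\<close>

lemma expected_reward_harmonic_rule:
  assumes F: "real_distribution F"
  shows "expected_reward n (\<lambda>k _. harmonic_rule n k) F = ennreal (1 / harm n) * expected_max n F"
proof -
  have meas: "(\<lambda>x. pos_walk x k) \<in> borel_measurable (PiM {1..n} (\<lambda>_. F))" if "k \<in> {1..n}" for k
    using measurable_walk[OF F, of k n] that unfolding pos_walk_def
    by (intro borel_measurable_max) auto
  have "expected_reward n (\<lambda>k _. harmonic_rule n k) F =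
      (\<Sum>k=1..n. (\<integral>\<^sup>+x. ennreal (pos_walk x k) \<partial>PiM {1..n} (\<lambda>_. F)) *
         ennreal (stop_prob (harmonic_rule n) k))"
    unfolding expected_reward_def reward_eq_sum
    by (rule nn_integral_weighted_stopping[OF F harmonic_rule_bounds meas]) (auto simp: pos_walk_def)
  also have "\<dots> = ennreal (1 / harm n) *
      (\<Sum>k=1..n. ennreal (1 / real k) * (\<integral>\<^sup>+x. ennreal (pos_walk x k) \<partial>PiM {1..n} (\<lambda>_. F)))"
    unfolding sum_distrib_left
    by (intro sum.cong refl)
       (simp add: stop_prob_harmonic_rule harm_nonneg ennreal_mult'' ac_simps
          del: times_divide_eq_right times_divide_eq_left mult_1_right)
  also have "\<dots> = ennreal (1 / harm n) * expected_max n F"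
    by (simp only: expected_max_eq[OF F] spitzer_identity[OF F order_refl])
  finally show ?thesis .
qed

text \<open>At time \<open>n\<close> the threshold is \<open>1\<close>, and almost surely the randomisation variable is at most \<open>1\<close>.\<close>

lemma stop_time_harmonic_rule_le:
  assumes F: "real_distribution F" and n: "n \<ge> 1"
  shows "AE (x, u) in walk_space n F. stop_time n (\<lambda>k _. harmonic_rule n k) x u \<le> enat n"
proof -
  interpret U: prob_space "PiM {1..n} (\<lambda>_. unif)"
    by (intro prob_space_PiM prob_space_unif)
  have one: "harmonic_rule n n = 1" using n by (simp add: harmonic_rule_def)
  have "AE t in unif. t \<le> 1" by (intro AE_uniform_measureI) auto
  then have *: "AE u in PiM {1..n} (\<lambda>_. unif). u n \<le> 1"
    using n by (intro AE_PiM_component prob_space_unif) auto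
  interpret X: prob_space "PiM {1..n} (\<lambda>_. F)"
    using F by (intro prob_space_PiM) (simp add: real_distribution_def)
  have "AE z in walk_space n F. snd z n \<le> 1"
  proof -
    have m: "(\<lambda>u. u n) \<in> borel_measurable (PiM {1..n} (\<lambda>_. unif))"
      using measurable_component_singleton[of n "{1..n}" "\<lambda>_. unif"] n by simp
    have "{z \<in> space (walk_space n F). snd z n \<le> 1} \<in> sets (walk_space n F)"
      unfolding walk_space_def using measurable_compose[OF measurable_snd m] by measurable
    then show ?thesis
      unfolding walk_space_def using *
      by (intro pair_sigma_finite.AE_pair_measure pair_sigma_finite.intro
            X.sigma_finite_measure_axioms U.sigma_finite_measure_axioms) auto
  qed
  then show ?thesis
  proof eventually_elim
    case (elim z)
    obtain x u where z: "z = (x, u)" by (cases z)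
    have "stop_time n (\<lambda>k _. harmonic_rule n k) x u \<le> enat n"
      unfolding stop_time_def using elim z n one by (intro INF_lower) auto
    then show ?case by (simp add: z)
  qed
qed

section \<open>Optimality\<close>

text \<open>
  The size \<open>n\<close> of the step down exceeds all that the other \<open>n - 1\<close> steps can gain, so a single step
  down leaves the walk negative up to time \<open>n\<close>.
\<close>

definition up_or_ruin :: "nat \<Rightarrow> real \<Rightarrow> real measure" where
  "up_or_ruin n p = distr (measure_pmf (bernoulli_pmf p)) borel (\<lambda>b. if b then 1 else - real n)"

lemma real_distribution_up_or_ruin: "real_distribution (up_or_ruin n p)"
  unfolding up_or_ruin_def by (intro prob_space.real_distribution_distr prob_space_measure_pmf) auto

lemma AE_up_or_ruin: "AE t in up_or_ruin n p. t = 1 \<or> t = - real n"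
  unfolding up_or_ruin_def by (subst AE_distr_iff) auto

lemma emeasure_up_or_ruin:
  assumes "p \<in> {0..1}"
  shows "emeasure (up_or_ruin n p) {1} = ennreal p"
proof -
  have "(\<lambda>b. if b then 1 else - real n) -` {1} = {True}"
    by (auto split: if_splits intro: ccontr)
  then show ?thesis using assms
    by (simp add: up_or_ruin_def emeasure_distr emeasure_pmf_single)
qed

definition all_up :: "nat \<Rightarrow> (nat \<Rightarrow> real) set" where
  "all_up k = {x. \<forall>i\<in>{1..k}. x i = 1}"

lemma measurable_all_up:
  assumes F: "real_distribution F" and k: "k \<le> n"
  shows "(indicator (all_up k) :: _ \<Rightarrow> real) \<in> borel_measurable (PiM {1..n} (\<lambda>_. F))"
proof -
  have m: "(\<lambda>x. x i) \<in> borel_measurable (PiM {1..n} (\<lambda>_. F))" if "i \<in> {1..n}" for i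
    by (rule measurable_increment[OF F that])
  have "Measurable.pred (PiM {1..n} (\<lambda>_. F)) (\<lambda>x. \<forall>i\<in>{1..k}. x i = 1)"
    using m k by (intro pred_intros_finite) auto
  then have "(\<lambda>x. indicator {x. \<forall>i\<in>{1..k}. x i = 1} x :: real) \<in> borel_measurable (PiM {1..n} (\<lambda>_. F))"
    by measurable
  then show ?thesis by (simp add: all_up_def)
qed

lemma nn_integral_all_up:
  assumes p: "p \<in> {0..1}" and k: "k \<le> n"
  shows "(\<integral>\<^sup>+x. ennreal (indicator (all_up k) x) \<partial>PiM {1..n} (\<lambda>_. up_or_ruin n p)) = ennreal (p ^ k)"
proof -
  let ?F = "up_or_ruin n p"
  interpret F: real_distribution ?F by (rule real_distribution_up_or_ruin)
  interpret product_prob_space "\<lambda>_. ?F" "{1..n}"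
    by (intro product_prob_spaceI F.prob_space_axioms)
  define B where "B = (\<lambda>i. if i \<le> k then {1::real} else UNIV)"
  have B: "B i \<in> sets ?F" for i by (auto simp: B_def)
  have "(\<integral>\<^sup>+x. ennreal (indicator (all_up k) x) \<partial>PiM {1..n} (\<lambda>_. ?F)) =
        (\<integral>\<^sup>+x. indicator (PiE {1..n} B) x \<partial>PiM {1..n} (\<lambda>_. ?F))"
    using k by (intro nn_integral_cong)
      (auto simp: indicator_def all_up_def B_def space_PiM PiE_iff split: if_splits)
  also have "\<dots> = emeasure (PiM {1..n} (\<lambda>_. ?F)) (PiE {1..n} B)"
    using B by (intro nn_integral_indicator sets_PiM_I_finite) auto
  also have "\<dots> = (\<Prod>i=1..n. emeasure ?F (B i))"
    using B by (intro emeasure_PiM) auto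
  also have "\<dots> = (\<Prod>i\<in>{1..k} \<union> {k<..n}. emeasure ?F (B i))"
    using k by (intro prod.cong) auto
  also have "\<dots> = (\<Prod>i=1..k. emeasure ?F (B i)) * (\<Prod>i\<in>{k<..n}. emeasure ?F (B i))"
    by (intro prod.union_disjoint) auto
  also have "(\<Prod>i\<in>{k<..n}. emeasure ?F (B i)) = 1"
    using F.emeasure_space_1 by (intro prod.neutral) (auto simp: B_def)
  also have "(\<Prod>i=1..k. emeasure ?F (B i)) = (\<Prod>i=1..k. ennreal p)"
    using p by (intro prod.cong) (auto simp: B_def emeasure_up_or_ruin)
  finally show ?thesis using p by (simp add: ennreal_power)
qed

text \<open>
  The sum counts the length of the initial run of steps \<open>1\<close> (up to \<open>n\<close>), and the walk reaches this
  height at the end of the run.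
\<close>

lemma sum_all_up_le_walk_max: "(\<Sum>k=1..n. indicator (all_up k) x) \<le> walk_max x n"
proof (induction n)
  case 0
  show ?case using walk_max_nonneg by simp
next
  case (Suc n)
  show ?case
  proof (cases "x \<in> all_up (Suc n)")
    case True
    then have "walk x (Suc n) = real (Suc n)" by (simp add: all_up_def walk_def)
    moreover have "(\<Sum>k=1..Suc n. indicator (all_up k) x) \<le> (\<Sum>k=1..Suc n. 1::real)"
      by (intro sum_mono) (auto simp: indicator_def)
    ultimately show ?thesis by (simp add: walk_max_Suc)
  next
    case False
    then show ?thesis using Suc by (simp add: walk_max_Suc)
  qed
qed

lemma pos_walk_up_or_ruin:
  assumes x: "\<And>i. i \<in> {1..n} \<Longrightarrow> x i = 1 \<or> x i = - real n" and k: "k \<in> {1..n}"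
  shows "pos_walk x k = real k * indicator (all_up k) x"
proof (cases "x \<in> all_up k")
  case True
  then show ?thesis by (simp add: pos_walk_def walk_def all_up_def)
next
  case False
  then obtain i where i: "i \<in> {1..k}" "x i = - real n" using x k by (force simp: all_up_def)
  have "walk x k = x i + (\<Sum>j\<in>{1..k} - {i}. x j)"
    unfolding walk_def using i by (intro sum.remove) auto
  also have "(\<Sum>j\<in>{1..k} - {i}. x j) \<le> (\<Sum>j\<in>{1..k} - {i}. 1)"
  proof (intro sum_mono)
    fix j assume "j \<in> {1..k} - {i}"
    then show "x j \<le> 1" using x[of j] k by auto
  qed
  also have "\<dots> \<le> real n" using i k by simp
  finally show ?thesis using False i by (simp add: pos_walk_def)
qed

text \<open>
  A positive reward at time \<open>k\<close> forces the first \<open>k\<close> steps to be \<open>1\<close>, and then the rule has seen exactly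
  what it sees along the path with all steps equal to \<open>1\<close>. So its thresholds may be frozen to those on
  that path without changing the reward.
\<close>

lemma reward_up_or_ruin:
  fixes r
  defines "\<rho> \<equiv> \<lambda>k. r k (restrict (pos_walk (\<lambda>_. 1)) {1..k})"
  assumes x: "\<And>i. i \<in> {1..n} \<Longrightarrow> x i = 1 \<or> x i = - real n"
  shows "reward n r x u = (\<Sum>k=1..n. (real k * indicator (all_up k) x) *
           indicator {u. stops_at \<rho> k u} u)"
  unfolding reward_eq_sum
proof (intro sum.cong refl)
  fix k assume k: "k \<in> {1..n}"
  show "pos_walk x k * indicator {u. stops_at (\<lambda>j. r j (restrict (pos_walk x) {1..j})) k u} u =
      (real k * indicator (all_up k) x) * indicator {u. stops_at \<rho> k u} u"
  proof (cases "x \<in> all_up k")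
    case False
    then have "pos_walk x k = 0" using pos_walk_up_or_ruin[OF x k] by simp
    then show ?thesis using False by simp
  next
    case True
    have "restrict (pos_walk x) {1..j} = restrict (pos_walk (\<lambda>_. 1)) {1..j}" if "j \<le> k" for j
      using True that by (intro restrict_ext) (auto simp: pos_walk_def walk_def all_up_def)
    then have "stops_at (\<lambda>j. r j (restrict (pos_walk x) {1..j})) k u = stops_at \<rho> k u"
      by (simp add: stops_at_def \<rho>_def)
    then show ?thesis using pos_walk_up_or_ruin[OF x k] by (simp add: indicator_def)
  qed
qed

lemma expected_reward_up_or_ruin:
  fixes r
  defines "\<rho> \<equiv> \<lambda>k. r k (restrict (pos_walk (\<lambda>_. 1)) {1..k})"
  assumes \<rho>: "\<And>j. j \<in> {1..n} \<Longrightarrow> \<rho> j \<in> {0..1}" and p: "p \<in> {0..1}"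
  shows "expected_reward n r (up_or_ruin n p) = ennreal (\<Sum>k=1..n. real k * stop_prob \<rho> k * p ^ k)"
proof -
  let ?F = "up_or_ruin n p"
  let ?P = "PiM {1..n} (\<lambda>_. ?F)" and ?U = "PiM {1..n} (\<lambda>_. unif)"
  note F = real_distribution_up_or_ruin[of n p]
  interpret F: real_distribution ?F by (rule F)
  interpret U: prob_space ?U by (intro prob_space_PiM prob_space_unif)
  have sp: "0 \<le> stop_prob \<rho> k" if "k \<in> {1..n}" for k
    using \<rho> that by (rule stop_prob_nonneg)
  have comp: "AE z in walk_space n ?F. fst z i = 1 \<or> fst z i = - real n" if "i \<in> {1..n}" for i
  proof -
    have "AE x in ?P. x i = 1 \<or> x i = - real n"
      using AE_up_or_ruin that by (intro AE_PiM_component F.prob_space_axioms) auto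
    then have "AE x in distr (walk_space n ?F) ?P fst. x i = 1 \<or> x i = - real n"
      unfolding walk_space_def by (simp only: U.distr_pair_fst)
    then show ?thesis
      unfolding walk_space_def by (rule AE_distrD[OF measurable_fst])
  qed
  have "AE z in walk_space n ?F. \<forall>i\<in>{1..n}. fst z i = 1 \<or> fst z i = - real n"
    using comp by (intro eventually_ball_finite) auto
  then have "AE z in walk_space n ?F. (case z of (x, u) \<Rightarrow> ennreal (reward n r x u)) =
     (case z of (x, u) \<Rightarrow> ennreal (\<Sum>k=1..n. (real k * indicator (all_up k) x) *
           indicator {u. stops_at \<rho> k u} u))"
  proof eventually_elim
    case (elim z)
    then show ?case
      unfolding split_beta \<rho>_def by (subst reward_up_or_ruin) auto
  qed
  then have "expected_reward n r ?F = (\<integral>\<^sup>+(x, u). ennreal (\<Sum>k=1..n. (real k * indicator (all_up k) x) *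
           indicator {u. stops_at \<rho> k u} u) \<partial>walk_space n ?F)"
    unfolding expected_reward_def by (rule nn_integral_cong_AE)
  also have "\<dots> = (\<Sum>k=1..n. (\<integral>\<^sup>+x. ennreal (real k * indicator (all_up k) x) \<partial>?P) *
      ennreal (stop_prob \<rho> k))"
    using measurable_all_up[OF F] \<rho> by (intro nn_integral_weighted_stopping F) auto
  also have "\<dots> = (\<Sum>k=1..n. ennreal (real k * stop_prob \<rho> k * p ^ k))"
  proof (intro sum.cong refl)
    fix k assume k: "k \<in> {1..n}"
    have "(\<integral>\<^sup>+x. ennreal (real k * indicator (all_up k) x) \<partial>?P) =
        (\<integral>\<^sup>+x. ennreal (real k) * ennreal (indicator (all_up k) x) \<partial>?P)"
      by (intro nn_integral_cong ennreal_mult) auto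
    also have "\<dots> = ennreal (real k) * (\<integral>\<^sup>+x. ennreal (indicator (all_up k) x) \<partial>?P)"
      using k by (intro nn_integral_cmult measurable_compose[OF measurable_all_up[OF F] measurable_ennreal]) auto
    also have "\<dots> = ennreal (real k) * ennreal (p ^ k)"
      using k by (subst nn_integral_all_up[OF p]) auto
    finally have *: "(\<integral>\<^sup>+x. ennreal (real k * indicator (all_up k) x) \<partial>?P) = ennreal (real k * p ^ k)"
      using p by (simp add: ennreal_mult)
    show "(\<integral>\<^sup>+x. ennreal (real k * indicator (all_up k) x) \<partial>?P) * ennreal (stop_prob \<rho> k) =
        ennreal (real k * stop_prob \<rho> k * p ^ k)"
      unfolding * using sp[OF k] p by (subst ennreal_mult[symmetric]) (auto simp: ac_simps)
  qed
  also have "\<dots> = ennreal (\<Sum>k=1..n. real k * stop_prob \<rho> k * p ^ k)"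
    using sp p by (intro sum_ennreal) auto
  finally show ?thesis .
qed

lemma expected_max_up_or_ruin_ge:
  assumes p: "p \<in> {0..1}"
  shows "ennreal (\<Sum>k=1..n. p ^ k) \<le> expected_max n (up_or_ruin n p)"
proof -
  let ?P = "PiM {1..n} (\<lambda>_. up_or_ruin n p)"
  note F = real_distribution_up_or_ruin[of n p]
  have "ennreal (\<Sum>k=1..n. p ^ k) = (\<Sum>k=1..n. ennreal (p ^ k))"
    using p by (subst sum_ennreal) auto
  also have "\<dots> = (\<Sum>k=1..n. \<integral>\<^sup>+x. ennreal (indicator (all_up k) x) \<partial>?P)"
    by (intro sum.cong refl nn_integral_all_up[OF p, symmetric]) auto
  also have "\<dots> = (\<integral>\<^sup>+x. (\<Sum>k=1..n. ennreal (indicator (all_up k) x)) \<partial>?P)"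
    by (intro nn_integral_sum[symmetric] measurable_compose[OF measurable_all_up[OF F] measurable_ennreal]) auto
  also have "\<dots> \<le> (\<integral>\<^sup>+x. ennreal (walk_max x n) \<partial>?P)"
    using sum_all_up_le_walk_max by (intro nn_integral_mono) (auto simp: sum_ennreal intro!: ennreal_leI)
  finally show ?thesis by (simp only: expected_max_eq[OF F])
qed

text \<open>
  Dividing the hypothesis by \<open>p\<close> shows that the polynomial \<open>\<Sum>k. (q k - c / k) p\<^sup>k\<close> has a nonnegative
  derivative on \<open>(0, 1)\<close>. Comparing its values at \<open>0\<close> and \<open>1\<close> replaces the integration against \<open>dp / p\<close>.
\<close>

lemma power_sum_comparison_imp_sum_le:
  fixes q :: "nat \<Rightarrow> real"
  assumes le: "\<And>p. 0 < p \<Longrightarrow> p < 1 \<Longrightarrow> c * (\<Sum>k=1..n. p ^ k) \<le> (\<Sum>k=1..n. real k * q k * p ^ k)"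
  shows "c * harm n \<le> (\<Sum>k=1..n. q k)"
proof -
  define G where "G = (\<lambda>p. \<Sum>k=1..n. (q k - c / real k) * p ^ k)"
  have "G 0 \<le> G 1"
  proof (rule DERIV_nonneg_imp_increasing_open[where f = G])
    show "continuous_on {0..1} G" unfolding G_def by (intro continuous_intros)
  next
    fix p :: real assume p: "0 < p" "p < 1"
    let ?D = "\<Sum>k=1..n. (q k - c / real k) * (real k * p ^ (k - 1))"
    have "DERIV G p :> ?D"
      unfolding G_def using DERIV_pow[of _ p] by (intro DERIV_sum DERIV_cmult) simp
    moreover have "p * ?D = (\<Sum>k=1..n. real k * q k * p ^ k) - c * (\<Sum>k=1..n. p ^ k)"
      unfolding sum_distrib_left sum_subtractf[symmetric]
    proof (intro sum.cong refl)
      fix k assume "k \<in> {1..n}"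
      then obtain l where "k = Suc l" by (cases k) auto
      then show "p * ((q k - c / real k) * (real k * p ^ (k - 1))) = real k * q k * p ^ k - c * p ^ k"
        by (simp add: field_simps del: of_nat_Suc)
    qed
    with le[OF p] have "0 \<le> p * ?D" by simp
    with p have "0 \<le> ?D" by (simp add: zero_le_mult_iff)
    ultimately show "\<exists>y. DERIV G p :> y \<and> y \<ge> 0" by blast
  qed simp
  moreover have "G 0 = 0" unfolding G_def by (intro sum.neutral) auto
  moreover have "G 1 = (\<Sum>k=1..n. q k) - c * harm n"
    by (simp add: G_def sum_subtractf harm_def sum_distrib_left divide_inverse)
  ultimately show ?thesis by simp
qed

text \<open>
  Testing the rule against all the distributions \<open>up_or_ruin n p\<close> at once: its stopping probabilities
  along the path of ones are the same for all \<open>p\<close>, and they cannot add up to more than \<open>1\<close>.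
\<close>

lemma distribution_free_constant_le:
  assumes n: "n \<ge> 1" and r: "stopping_rule n r" and c: "c \<ge> 0"
    and good: "\<And>F. real_distribution F \<Longrightarrow> expected_reward n r F \<ge> ennreal c * expected_max n F"
  shows "c \<le> 1 / harm n"
proof -
  define \<rho> where "\<rho> = (\<lambda>k. r k (restrict (pos_walk (\<lambda>_. 1)) {1..k}))"
  have \<rho>: "\<rho> j \<in> {0..1}" if "j \<in> {1..n}" for j
    using r that unfolding stopping_rule_def \<rho>_def by (auto simp: space_PiM)
  have "c * (\<Sum>k=1..n. p ^ k) \<le> (\<Sum>k=1..n. real k * stop_prob \<rho> k * p ^ k)"
    if p: "0 < p" "p < 1" for p
  proof -
    have sp: "0 \<le> stop_prob \<rho> k" if "k \<in> {1..n}" for k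
    using \<rho> that by (rule stop_prob_nonneg)
    have "ennreal (c * (\<Sum>k=1..n. p ^ k)) = ennreal c * ennreal (\<Sum>k=1..n. p ^ k)"
      using c p by (intro ennreal_mult sum_nonneg) auto
    also have "\<dots> \<le> ennreal c * expected_max n (up_or_ruin n p)"
      using p by (intro mult_left_mono expected_max_up_or_ruin_ge) auto
    also have "\<dots> \<le> expected_reward n r (up_or_ruin n p)"
      by (rule good[OF real_distribution_up_or_ruin])
    also have "\<dots> = ennreal (\<Sum>k=1..n. real k * stop_prob \<rho> k * p ^ k)"
      unfolding \<rho>_def using p \<rho> by (intro expected_reward_up_or_ruin) (auto simp: \<rho>_def)
    finally show ?thesis
      using sp p by (subst (asm) ennreal_le_iff) (auto intro!: sum_nonneg)
  qed
  then have "c * harm n \<le> (\<Sum>k=1..n. stop_prob \<rho> k)"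
    by (rule power_sum_comparison_imp_sum_le)
  also have "\<dots> \<le> 1"
    unfolding sum_stop_prob using \<rho> prod_nonneg[of "{1..n}" "\<lambda>j. 1 - \<rho> j"] by auto
  finally show ?thesis using n by (simp add: pos_le_divide_eq)
qed

theorem theorem2:
  fixes n :: nat
  assumes "n \<ge> 1"
  shows "(\<exists>r. stopping_rule n r \<and>
            (\<forall>F. real_distribution F \<longrightarrow>
               (AE (x, u) in walk_space n F. stop_time n r x u \<le> enat n) \<and>
               expected_reward n r F \<ge> ennreal (1 / harm n) * expected_max n F)) \<and>
         (\<forall>c::real. c > 1 / harm n \<longrightarrow>
            \<not> (\<exists>r. stopping_rule n r \<and>
                 (\<forall>F. real_distribution F \<longrightarrow>
                    expected_reward n r F \<ge> ennreal c * expected_max n F)))"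
proof (intro conjI allI impI)
  have "stopping_rule n (\<lambda>k _. harmonic_rule n k)"
    using harmonic_rule_bounds unfolding stopping_rule_def by simp
  then show "\<exists>r. stopping_rule n r \<and>
            (\<forall>F. real_distribution F \<longrightarrow>
               (AE (x, u) in walk_space n F. stop_time n r x u \<le> enat n) \<and>
               expected_reward n r F \<ge> ennreal (1 / harm n) * expected_max n F)"
    using stop_time_harmonic_rule_le[OF _ assms] expected_reward_harmonic_rule
    by (intro exI[of _ "\<lambda>k _. harmonic_rule n k"]) auto
next
  fix c :: real assume c: "c > 1 / harm n"
  have "c \<ge> 0" using c harm_nonneg[of n, where ?'a = real]
    by (meson divide_nonneg_nonneg less_eq_real_def order_trans zero_le_one)
  then show "\<not> (\<exists>r. stopping_rule n r \<and>
                 (\<forall>F. real_distribution F \<longrightarrow>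
                    expected_reward n r F \<ge> ennreal c * expected_max n F))"
    using distribution_free_constant_le[OF assms] c by fastforce
qed

end
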